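(* For every integer $\gamma\ge 0$, the Koszul dual $\mathsf{Dias}_\gamma^!$ of the operad $\mathsf{Dias}_\gamma$ (called the $\gamma$-polydendriform operad $\mathsf{Dendr}_\gamma$) admits the following presentation: it is generated by the $2\gamma$ binary elements $\leftharpoonup_a,\rightharpoonup_a$, $a\in[\gamma]$, and its space of relations is the subspace of $\mathbf{Free}(\{\leftharpoonup_a,\rightharpoonup_a\})(3)$ spanned by \begin{itemize} \item $\leftharpoonup_a\circ_1\rightharpoonup_{a'}-\rightharpoonup_{a'}\circ_2\leftharpoonup_a$ for $a,a'\in[\gamma]$; \item $\leftharpoonup_a\circ_1\leftharpoonup_b-\leftharpoonup_a\circ_2\rightharpoonup_b$ for $a<b\in[\gamma]$; \item $\rightharpoonup_a\circ_1\leftharpoonup_b-\rightharpoonup_a\circ_2\rightharpoonup_b$ for $a<b\in[\gamma]$; \item $\leftharpoonup_a\circ_1\leftharpoonup_b-\leftharpoonup_a\circ_2\leftharpoonup_b$ for $a<b\in[\gamma]$; \item $\rightharpoonup_a\circ_1\rightharpoonup_b-\rightharpoonup_a\circ_2\rightharpoonup_b$ for $a<b\in[\gamma]$; \item $\leftharpoonup_d\circ_1\leftharpoonup_d-\sum_{c\in[d]}\left(\leftharpoonup_d\circ_2\leftharpoonup_c+\leftharpoonup_d\circ_2\rightharpoonup_c\right)$ for $d\in[\gamma]$; \item $\sum_{c\in[d]}\left(\rightharpoonup_d\circ_1\rightharpoonup_c+\rightharpoonup_d\circ_1\leftharpoonup_c\right)-\rightharpoonup_d\circ_2\rightharpoonup_d$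 for $d\in[\gamma]$. \end{itemize}
   Context: All operads are nonsymmetric operads in vector spaces over a field $\mathbb{K}$ of characteristic zero, with partial compositions $\circ_i$. For a set $G$ of binary generators, $\mathbf{Free}(G)$ is the free nonsymmetric operad on $G$ (syntax trees with internal nodes labeled by $G$); $\mathbf{Free}(G)(3)$ has basis the trees $x\circ_1 y$ and $x\circ_2 y$ for $x,y\in G$. An operad $\mathcal{O}$ admits the presentation $(G,R)$ with $R\subseteq\mathbf{Free}(G)(3)$ if $\mathcal{O}\cong\mathbf{Free}(G)/\langle R\rangle$, where $\langle R\rangle$ is the operad ideal generated by $R$. $[n]=\{1,\dots,n\}$. The operad $\mathsf{Dias}_\gamma$: $\mathsf{Dias}_\gamma(n)$ has basis the words of length $n$ on the alphabet $\{0,1,\dots,\gamma\}$ having exactly one occurrence of $0$, and for words $x=x_1\cdots x_n$, $y=y_1\cdots y_m$, $x\circ_i y=x_1\cdots x_{i-1}\,\max(x_i,y_1)\cdots\max(x_i,y_m)\,x_{i+1}\cdots x_n$. It is known that $\mathsf{Dias}_\gamma$ is binary and quadratic: with $G$ the basis $\{0a, a0 : a\in[\gamma]\}$ of $\mathsf{Dias}_\gamma(2)$, the canonical map $\mathbf{Free}(G)\to\mathsf{Dias}_\gamma$ is surjective and its kernel is generated by its arity-3 part $R$. Koszul dual: for a binary quadratic operad with presentation $(G,R)$, its Koszul dual is the operad with presentation $(G,R^\perp)$, where $R^\perp$ is the annihilator of $R$ for the bilinear form on $\mathbf{Free}(G)(3)$ given on basis trees by $\langle x\circ_i y, x'\circ_{i'}y'\rangle=1$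 if $x=x',y=y',i=i'=1$, $=-1$ if $x=x',y=y',i=i'=2$, and $0$ otherwise.
   Formalization: The fourth and fifth families are corrected to $\leftharpoonup_b\circ_1\leftharpoonup_a-\leftharpoonup_a\circ_2\leftharpoonup_b$ and $\rightharpoonup_a\circ_1\rightharpoonup_b-\rightharpoonup_b\circ_2\rightharpoonup_a$ ($a<b$); as printed the claim fails for $\gamma\ge2$. *)

theory Defs
  imports Complex_Main "HOL-Library.Poly_Mapping" "HOL-Library.Tree"
begin

section \<open>Nonsymmetric operads, morphisms, ideals and quotients\<close>

text \<open>
  The data of a nonsymmetric operad in vector spaces. All arities share one element type, so the
  operations carry arity arguments: \<open>pcomp P n m i x y\<close> is \<open>x \<circ>\<^sub>i y\<close> for \<open>x\<close> of arity \<open>n\<close>, \<open>y\<close> of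
  arity \<open>m\<close> and \<open>1 \<le> i \<le> n\<close>; it has arity \<open>n + m - 1\<close>.
\<close>

record ('k, 'a) ns_operad =
  sp :: "nat \<Rightarrow> 'a set"
  vadd :: "nat \<Rightarrow> 'a \<Rightarrow> 'a \<Rightarrow> 'a"
  vscale :: "nat \<Rightarrow> 'k \<Rightarrow> 'a \<Rightarrow> 'a"
  opunit :: 'a
  pcomp :: "nat \<Rightarrow> nat \<Rightarrow> nat \<Rightarrow> 'a \<Rightarrow> 'a \<Rightarrow> 'a"

definition operad_isomorphism ::
    "('k, 'a) ns_operad \<Rightarrow> ('k, 'b) ns_operad \<Rightarrow> (nat \<Rightarrow> 'a \<Rightarrow> 'b) \<Rightarrow> bool" where
  "operad_isomorphism P Q \<phi> \<longleftrightarrow>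
     (\<forall>n. bij_betw (\<phi> n) (sp P n) (sp Q n)) \<and>
     (\<forall>n. \<forall>x\<in>sp P n. \<forall>y\<in>sp P n. \<phi> n (vadd P n x y) = vadd Q n (\<phi> n x) (\<phi> n y)) \<and>
     (\<forall>n c. \<forall>x\<in>sp P n. \<phi> n (vscale P n c x) = vscale Q n c (\<phi> n x)) \<and>
     \<phi> 1 (opunit P) = opunit Q \<and>
     (\<forall>n m. \<forall>i\<in>{1..n}. \<forall>x\<in>sp P n. \<forall>y\<in>sp P m.
        \<phi> (n + m - 1) (pcomp P n m i x y) = pcomp Q n m i (\<phi> n x) (\<phi> m y))"

definition operad_isomorphic :: "('k, 'a) ns_operad \<Rightarrow> ('k, 'b) ns_operad \<Rightarrow> bool" where
  "operad_isomorphic P Q \<longleftrightarrow> (\<exists>\<phi>. operad_isomorphism P Q \<phi>)"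

definition operad_ideal :: "('k, 'a) ns_operad \<Rightarrow> (nat \<Rightarrow> 'a set) \<Rightarrow> bool" where
  "operad_ideal P I \<longleftrightarrow>
     (\<forall>n. I n \<subseteq> sp P n \<and> I n \<noteq> {}) \<and>
     (\<forall>n. \<forall>x\<in>I n. \<forall>y\<in>I n. vadd P n x y \<in> I n) \<and>
     (\<forall>n c. \<forall>x\<in>I n. vscale P n c x \<in> I n) \<and>
     (\<forall>n m. \<forall>i\<in>{1..n}. \<forall>x\<in>I n. \<forall>y\<in>sp P m. pcomp P n m i x y \<in> I (n + m - 1)) \<and>
     (\<forall>n m. \<forall>i\<in>{1..n}. \<forall>x\<in>sp P n. \<forall>y\<in>I m. pcomp P n m i x y \<in> I (n + m - 1))"

text \<open>The ideal generated by a set \<open>R\<close> of elements of arity 3.\<close>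

definition generated_ideal :: "('k, 'a) ns_operad \<Rightarrow> 'a set \<Rightarrow> nat \<Rightarrow> 'a set" where
  "generated_ideal P R n = \<Inter>{I n | I. operad_ideal P I \<and> R \<subseteq> I 3}"

definition operad_coset :: "('k, 'a) ns_operad \<Rightarrow> (nat \<Rightarrow> 'a set) \<Rightarrow> nat \<Rightarrow> 'a \<Rightarrow> 'a set" where
  "operad_coset P I n x = vadd P n x ` I n"

text \<open>
  When \<open>I\<close> is an ideal, each union below ranges over copies of one and the same coset.
\<close>

definition quotient_operad ::
    "('k, 'a) ns_operad \<Rightarrow> (nat \<Rightarrow> 'a set) \<Rightarrow> ('k, 'a set) ns_operad" where
  "quotient_operad P I =
     \<lparr> sp = (\<lambda>n. operad_coset P I n ` sp P n),
       vadd = (\<lambda>n A B. \<Union>a\<in>A. \<Union>b\<in>B. operad_coset P I n (vadd P n a b)),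
       vscale = (\<lambda>n c A. \<Union>a\<in>A. operad_coset P I n (vscale P n c a)),
       opunit = operad_coset P I 1 (opunit P),
       pcomp = (\<lambda>n m i A B. \<Union>a\<in>A. \<Union>b\<in>B.
                  operad_coset P I (n + m - 1) (pcomp P n m i a b)) \<rparr>"


section \<open>Operads with a basis stable under partial composition\<close>

definition pm_scale :: "'k::field \<Rightarrow> ('b \<Rightarrow>\<^sub>0 'k) \<Rightarrow> ('b \<Rightarrow>\<^sub>0 'k)" where
  "pm_scale c = Poly_Mapping.map ((*) c)"

lemma lookup_pm_scale [simp]: "Poly_Mapping.lookup (pm_scale c f) x = c * Poly_Mapping.lookup f x"
  by (simp add: pm_scale_def Poly_Mapping.map.rep_eq when_def)

global_interpretation pm: vector_space "pm_scale :: 'k::field \<Rightarrow> ('b \<Rightarrow>\<^sub>0 'k) \<Rightarrow> ('b \<Rightarrow>\<^sub>0 'k)"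
  by unfold_locales (auto intro!: poly_mapping_eqI simp: lookup_add algebra_simps)

definition bilinear_ext ::
    "('b \<Rightarrow> 'c \<Rightarrow> 'd) \<Rightarrow> ('b \<Rightarrow>\<^sub>0 'k::field) \<Rightarrow> ('c \<Rightarrow>\<^sub>0 'k) \<Rightarrow> ('d \<Rightarrow>\<^sub>0 'k)" where
  "bilinear_ext h f g =
     (\<Sum>x\<in>Poly_Mapping.keys f. \<Sum>y\<in>Poly_Mapping.keys g.
        Poly_Mapping.single (h x y) (Poly_Mapping.lookup f x * Poly_Mapping.lookup g y))"

text \<open>\<open>B n\<close> is the basis in arity \<open>n\<close>, \<open>u\<close> the unit and \<open>pc i x y\<close> is \<open>x \<circ>\<^sub>i y\<close> on basis elements.\<close>

definition operad_of_basis ::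
    "(nat \<Rightarrow> 'b set) \<Rightarrow> 'b \<Rightarrow> (nat \<Rightarrow> 'b \<Rightarrow> 'b \<Rightarrow> 'b) \<Rightarrow> ('k::field, 'b \<Rightarrow>\<^sub>0 'k) ns_operad" where
  "operad_of_basis B u pc =
     \<lparr> sp = (\<lambda>n. {f. Poly_Mapping.keys f \<subseteq> B n}),
       vadd = (\<lambda>n. (+)),
       vscale = (\<lambda>n. pm_scale),
       opunit = Poly_Mapping.single u 1,
       pcomp = (\<lambda>n m i. bilinear_ext (pc i)) \<rparr>"


section \<open>Free operads on binary generators, presentations, Koszul duals\<close>

text \<open>
  Since all generators are binary, syntax trees are binary trees with labelled internal nodes, and
  the arity is the number of leaves, \<^const>\<open>size1\<close>. \<open>graft t i s\<close> plugs the root of \<open>s\<close> into the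
  \<open>i\<close>-th leaf of \<open>t\<close>, leaves being numbered from left to right starting at 1.
\<close>

fun graft :: "'g tree \<Rightarrow> nat \<Rightarrow> 'g tree \<Rightarrow> 'g tree" where
  "graft Leaf i s = s"
| "graft (Node l g r) i s =
     (if i \<le> size1 l then Node (graft l i s) g r else Node l g (graft r (i - size1 l) s))"

definition free_operad :: "'g set \<Rightarrow> ('k::field, 'g tree \<Rightarrow>\<^sub>0 'k) ns_operad" where
  "free_operad G =
     operad_of_basis (\<lambda>n. {t. size1 t = n \<and> set_tree t \<subseteq> G}) Leaf (\<lambda>i s t. graft s i t)"

text \<open>
  The value of a syntax tree in \<open>P\<close> when the generator \<open>g\<close> is sent to \<open>\<iota> g\<close>: the tree with root \<open>g\<close>
  and subtrees \<open>l\<close>, \<open>r\<close> is \<open>(g \<circ>\<^sub>2 r) \<circ>\<^sub>1 l\<close>.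
\<close>

fun operad_eval :: "('k, 'a) ns_operad \<Rightarrow> ('g \<Rightarrow> 'a) \<Rightarrow> 'g tree \<Rightarrow> 'a" where
  "operad_eval P \<iota> Leaf = opunit P"
| "operad_eval P \<iota> (Node l g r) =
     pcomp P (size1 r + 1) (size1 l) 1
       (pcomp P 2 (size1 r) 2 (\<iota> g) (operad_eval P \<iota> r)) (operad_eval P \<iota> l)"

definition presented_operad ::
    "'g set \<Rightarrow> ('g tree \<Rightarrow>\<^sub>0 'k::field) set \<Rightarrow> ('k, ('g tree \<Rightarrow>\<^sub>0 'k) set) ns_operad" where
  "presented_operad G R = quotient_operad (free_operad G) (generated_ideal (free_operad G) R)"

definition admits_presentation ::
    "('k::field, 'a) ns_operad \<Rightarrow> 'g set \<Rightarrow> ('g tree \<Rightarrow>\<^sub>0 'k) set \<Rightarrow> bool" where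
  "admits_presentation P G R \<longleftrightarrow>
     R \<subseteq> sp (free_operad G :: ('k, _) ns_operad) 3 \<and> operad_isomorphic P (presented_operad G R)"

definition corolla :: "'g \<Rightarrow> 'g tree" where
  "corolla g = Node Leaf g Leaf"

text \<open>The tree \<open>x \<circ>\<^sub>i y\<close> for generators \<open>x\<close>, \<open>y\<close> and \<open>i = 1, 2\<close>.\<close>

definition gen_comp :: "nat \<Rightarrow> 'g \<Rightarrow> 'g \<Rightarrow> 'g tree" where
  "gen_comp i x y = graft (corolla x) i (corolla y)"

definition tree_form :: "'g tree \<Rightarrow> 'g tree \<Rightarrow> 'k::field" where
  "tree_form s t =
     (if \<exists>x y. s = gen_comp 1 x y \<and> t = gen_comp 1 x y then 1
      else if \<exists>x y. s = gen_comp 2 x y \<and> t = gen_comp 2 x y then - 1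
      else 0)"

definition koszul_form :: "('g tree \<Rightarrow>\<^sub>0 'k::field) \<Rightarrow> ('g tree \<Rightarrow>\<^sub>0 'k) \<Rightarrow> 'k" where
  "koszul_form f g =
     (\<Sum>s\<in>Poly_Mapping.keys f. \<Sum>t\<in>Poly_Mapping.keys g.
        Poly_Mapping.lookup f s * Poly_Mapping.lookup g t * tree_form s t)"

definition annihilator ::
    "'g set \<Rightarrow> ('g tree \<Rightarrow>\<^sub>0 'k::field) set \<Rightarrow> ('g tree \<Rightarrow>\<^sub>0 'k) set" where
  "annihilator G R = {f \<in> sp (free_operad G) 3. \<forall>r\<in>R. koszul_form r f = 0}"

definition koszul_dual ::
    "'g set \<Rightarrow> ('g tree \<Rightarrow>\<^sub>0 'k::field) set \<Rightarrow> ('k, ('g tree \<Rightarrow>\<^sub>0 'k) set) ns_operad" where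
  "koszul_dual G R = presented_operad G (annihilator G R)"


section \<open>The operad \<open>Dias\<close> and its Koszul dual\<close>

definition dias_words :: "nat \<Rightarrow> nat \<Rightarrow> nat list set" where
  "dias_words \<gamma> n = {w. length w = n \<and> set w \<subseteq> {0..\<gamma>} \<and> count_list w 0 = 1}"

definition dias_comp :: "nat \<Rightarrow> nat list \<Rightarrow> nat list \<Rightarrow> nat list" where
  "dias_comp i x y = take (i - 1) x @ map (max (x ! (i - 1))) y @ drop i x"

definition Dias :: "nat \<Rightarrow> ('k::field_char_0, nat list \<Rightarrow>\<^sub>0 'k) ns_operad" where
  "Dias \<gamma> = operad_of_basis (dias_words \<gamma>) [0] dias_comp"

text \<open>The canonical map from the free operad on the basis of \<open>Dias \<gamma>\<close> in arity 2 to \<open>Dias \<gamma>\<close>.\<close>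

definition dias_canonical ::
    "nat \<Rightarrow> (nat list tree \<Rightarrow>\<^sub>0 'k::field_char_0) \<Rightarrow> (nat list \<Rightarrow>\<^sub>0 'k)" where
  "dias_canonical \<gamma> f =
     (\<Sum>t\<in>Poly_Mapping.keys f. pm_scale (Poly_Mapping.lookup f t)
        (operad_eval (Dias \<gamma>) (\<lambda>w. Poly_Mapping.single w 1) t))"

text \<open>The words of length 2, i.e. \<open>0a\<close> and \<open>a0\<close> with \<open>1 \<le> a \<le> \<gamma>\<close>.\<close>

definition dias_gens :: "nat \<Rightarrow> nat list set" where
  "dias_gens \<gamma> = dias_words \<gamma> 2"

definition dias_relations :: "nat \<Rightarrow> (nat list tree \<Rightarrow>\<^sub>0 'k::field_char_0) set" where
  "dias_relations \<gamma> = {f \<in> sp (free_operad (dias_gens \<gamma>)) 3. dias_canonical \<gamma> f = 0}"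

definition Dendr ::
    "nat \<Rightarrow> ('k::field_char_0, (nat list tree \<Rightarrow>\<^sub>0 'k) set) ns_operad" where
  "Dendr \<gamma> = koszul_dual (dias_gens \<gamma>) (dias_relations \<gamma>)"


section \<open>The polydendriform presentation\<close>

datatype dendr_gen = Lharp nat | Rharp nat

definition dendr_gens :: "nat \<Rightarrow> dendr_gen set" where
  "dendr_gens \<gamma> = Lharp ` {1..\<gamma>} \<union> Rharp ` {1..\<gamma>}"

definition quad :: "nat \<Rightarrow> 'g \<Rightarrow> 'g \<Rightarrow> ('g tree \<Rightarrow>\<^sub>0 'k::field)" where
  "quad i x y = Poly_Mapping.single (gen_comp i x y) 1"

text \<open>
  In the fourth and fifth families the two indices trade places between the two terms. This is
  forced by the compositions of \<open>Dias \<gamma>\<close>: for \<open>a < b\<close> one has \<open>0b \<circ>\<^sub>1 0a = 0ab = 0a \<circ>\<^sub>2 0b\<close> and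
  \<open>a0 \<circ>\<^sub>1 b0 = ba0 = b0 \<circ>\<^sub>2 a0\<close>. With uncrossed indices (\<open>Lharp a \<circ>\<^sub>1 Lharp b - Lharp a \<circ>\<^sub>2 Lharp b\<close>)
  the fourth and second families would give the relation
  \<open>Lharp a \<circ>\<^sub>2 (Lharp b - Rharp b) = 0\<close>, whereas in \<open>Dendr \<gamma>\<close> a composition \<open>x \<circ>\<^sub>2 y\<close> of nonzero
  elements of arity 2 never vanishes.
\<close>

definition dendr_relators :: "nat \<Rightarrow> (dendr_gen tree \<Rightarrow>\<^sub>0 'k::field_char_0) set" where
  "dendr_relators \<gamma> =
     {quad 1 (Lharp a) (Rharp a') - quad 2 (Rharp a') (Lharp a) | a a'.
        a \<in> {1..\<gamma>} \<and> a' \<in> {1..\<gamma>}} \<union>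
     {quad 1 (Lharp a) (Lharp b) - quad 2 (Lharp a) (Rharp b) | a b.
        a \<in> {1..\<gamma>} \<and> b \<in> {1..\<gamma>} \<and> a < b} \<union>
     {quad 1 (Rharp a) (Lharp b) - quad 2 (Rharp a) (Rharp b) | a b.
        a \<in> {1..\<gamma>} \<and> b \<in> {1..\<gamma>} \<and> a < b} \<union>
     {quad 1 (Lharp b) (Lharp a) - quad 2 (Lharp a) (Lharp b) | a b.
        a \<in> {1..\<gamma>} \<and> b \<in> {1..\<gamma>} \<and> a < b} \<union>
     {quad 1 (Rharp a) (Rharp b) - quad 2 (Rharp b) (Rharp a) | a b.
        a \<in> {1..\<gamma>} \<and> b \<in> {1..\<gamma>} \<and> a < b} \<union>
     {quad 1 (Lharp d) (Lharp d) -
        (\<Sum>c\<in>{1..d}. quad 2 (Lharp d) (Lharp c) + quad 2 (Lharp d) (Rharp c)) | d.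
        d \<in> {1..\<gamma>}} \<union>
     {(\<Sum>c\<in>{1..d}. quad 1 (Rharp d) (Rharp c) + quad 1 (Rharp d) (Lharp c)) -
        quad 2 (Rharp d) (Rharp d) | d.
        d \<in> {1..\<gamma>}}"

definition dendr_relations :: "nat \<Rightarrow> (dendr_gen tree \<Rightarrow>\<^sub>0 'k::field_char_0) set" where
  "dendr_relations \<gamma> = pm.span (dendr_relators \<gamma>)"

end

theory Submission
  imports Defs
begin

text \<open>
  The canonical map from the free operad to \<open>Dias \<gamma>\<close> sends every tree of arity 3 to a single word.
  Its kernel \<open>R\<close> is therefore spanned by the differences of trees with the same word, and \<open>R\<^sup>\<bottom>\<close> is
  spanned by the sums, one for each word, of all trees evaluating to it, with sign \<open>1\<close> for \<open>x \<circ>\<^sub>1 y\<close>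
  and \<open>- 1\<close> for \<open>x \<circ>\<^sub>2 y\<close>. Under \<open>0a \<mapsto> Lharp a\<close>, \<open>a0 \<mapsto> Rharp a\<close> these sums are precisely the
  listed relators: the seven families correspond to the words \<open>b0a\<close>, \<open>0ba\<close>, \<open>ab0\<close>, \<open>0ab\<close>, \<open>ba0\<close>
  (with \<open>a < b\<close> in the last four) and \<open>0dd\<close>, \<open>dd0\<close>.
\<close>

section \<open>Linear extension of a map between bases\<close>

text \<open>The functor from sets to free vector spaces. It serves twice: with an injective
  \<open>h\<close> to rename trees, and with a non-injective \<open>h\<close> to evaluate trees,
  where coefficients of keys with the same image add up.\<close>

definition pm_push :: "('b \<Rightarrow> 'c) \<Rightarrow> ('b \<Rightarrow>\<^sub>0 'k::field) \<Rightarrow> ('c \<Rightarrow>\<^sub>0 'k)" where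
  "pm_push h f =
     (\<Sum>x\<in>Poly_Mapping.keys f. Poly_Mapping.single (h x) (Poly_Mapping.lookup f x))"

text \<open>Supports shrink when coefficients cancel; a common finite index set lets sums for
  different arguments be compared term by term.\<close>

lemma pm_push_superset:
  assumes "finite A" "Poly_Mapping.keys f \<subseteq> A"
  shows "pm_push h f = (\<Sum>x\<in>A. Poly_Mapping.single (h x) (Poly_Mapping.lookup f x))"
  unfolding pm_push_def
  by (rule sum.mono_neutral_left) (use assms in \<open>auto simp: in_keys_iff\<close>)

lemma pm_push_zero [simp]: "pm_push h 0 = 0"
  by (simp add: pm_push_def)

lemma pm_push_add: "pm_push h (f + g) = pm_push h f + pm_push h g"
proof -
  let ?A = "Poly_Mapping.keys f \<union> Poly_Mapping.keys g"
  show ?thesis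
    using Poly_Mapping.keys_add[of f g]
    by (simp add: pm_push_superset[of ?A] lookup_add single_add sum.distrib)
qed

lemma keys_pm_scale_subset: "Poly_Mapping.keys (pm_scale c f) \<subseteq> Poly_Mapping.keys f"
  by (auto simp: in_keys_iff)

lemma pm_scale_single [simp]:
  "pm_scale c (Poly_Mapping.single x a) = Poly_Mapping.single x (c * a)"
  by (auto intro!: poly_mapping_eqI simp: lookup_single when_def)

lemma pm_push_scale: "pm_push h (pm_scale c f) = pm_scale c (pm_push h f)"
  by (simp add: pm_push_superset[OF finite_keys keys_pm_scale_subset] pm_push_def[of h f]
      pm.scale_sum_right)

lemma pm_push_single [simp]:
  "pm_push h (Poly_Mapping.single x a) = Poly_Mapping.single (h x) a"
  by (simp add: pm_push_superset[of "{x}"])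

lemma pm_push_sum: "pm_push h (\<Sum>x\<in>A. f x) = (\<Sum>x\<in>A. pm_push h (f x))"
  by (induction A rule: infinite_finite_induct) (simp_all add: pm_push_add)

lemma pm_push_diff: "pm_push h (f - g) = pm_push h f - pm_push h g"
  by (metis diff_add_cancel eq_diff_eq pm_push_add)

lemma lookup_pm_push:
  "Poly_Mapping.lookup (pm_push h f) y =
     (\<Sum>x\<in>Poly_Mapping.keys f. Poly_Mapping.lookup f x when h x = y)"
  by (simp add: pm_push_def lookup_sum lookup_single)

lemma lookup_pm_push_inj:
  assumes "inj_on h A" "Poly_Mapping.keys f \<subseteq> A" "x \<in> A"
  shows "Poly_Mapping.lookup (pm_push h f) (h x) = Poly_Mapping.lookup f x"
proof -
  have "Poly_Mapping.lookup (pm_push h f) (h x) =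
      (\<Sum>z\<in>Poly_Mapping.keys f. Poly_Mapping.lookup f z when z = x)"
    unfolding lookup_pm_push using assms by (intro sum.cong) (auto simp: when_def dest: inj_onD)
  then show ?thesis
    by (simp add: when_def in_keys_iff)
qed

text \<open>Only an inclusion: coefficients may cancel where \<open>h\<close> identifies
  keys.\<close>

lemma keys_pm_push_subset: "Poly_Mapping.keys (pm_push h f) \<subseteq> h ` Poly_Mapping.keys f"
proof
  fix y assume "y \<in> Poly_Mapping.keys (pm_push h f)"
  then have "(\<Sum>x\<in>Poly_Mapping.keys f. Poly_Mapping.lookup f x when h x = y) \<noteq> 0"
    by (simp add: in_keys_iff lookup_pm_push)
  then obtain x where "x \<in> Poly_Mapping.keys f" "(Poly_Mapping.lookup f x when h x = y) \<noteq> 0"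
    by (meson sum.not_neutral_contains_not_neutral)
  then show "y \<in> h ` Poly_Mapping.keys f"
    by (auto simp: when_def split: if_splits)
qed

lemma keys_pm_push_inj:
  assumes "inj_on h (Poly_Mapping.keys f)"
  shows "Poly_Mapping.keys (pm_push h f) = h ` Poly_Mapping.keys f"
proof
  show "h ` Poly_Mapping.keys f \<subseteq> Poly_Mapping.keys (pm_push h f)"
    using lookup_pm_push_inj[OF assms subset_refl] by (auto simp: in_keys_iff)
qed (rule keys_pm_push_subset)

lemma sum_single_lookup:
  assumes "finite A" "Poly_Mapping.keys f \<subseteq> A"
  shows "(\<Sum>x\<in>A. Poly_Mapping.single x (Poly_Mapping.lookup f x)) = f"
  using assms
  by (intro poly_mapping_eqI) (auto simp: lookup_sum lookup_single when_def in_keys_iff)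

lemma pm_push_inverse:
  assumes "Poly_Mapping.keys f \<subseteq> A" "\<And>x. x \<in> A \<Longrightarrow> v (u x) = x"
  shows "pm_push v (pm_push u f) = f"
proof -
  have "pm_push v (pm_push u f) =
      (\<Sum>x\<in>Poly_Mapping.keys f. Poly_Mapping.single (v (u x)) (Poly_Mapping.lookup f x))"
    by (simp add: pm_push_def[of u] pm_push_sum)
  also have "\<dots> = (\<Sum>x\<in>Poly_Mapping.keys f. Poly_Mapping.single x (Poly_Mapping.lookup f x))"
    using assms by (intro sum.cong) auto
  also have "\<dots> = f"
    by (simp add: sum_single_lookup)
  finally show ?thesis .
qed

lemma bij_betw_pm_push:
  assumes "bij_betw h A B"
  shows "bij_betw (pm_push h :: _ \<Rightarrow> _ \<Rightarrow>\<^sub>0 'k::field)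
           {f. Poly_Mapping.keys f \<subseteq> A} {f. Poly_Mapping.keys f \<subseteq> B}"
proof (rule bij_betw_byWitness[where f' = "pm_push (inv_into A h)"])
  show "\<forall>f\<in>{f. Poly_Mapping.keys f \<subseteq> A}. pm_push (inv_into A h) (pm_push h f) = f"
    using assms by (blast intro: pm_push_inverse[where A = A] bij_betw_inv_into_left)
  show "\<forall>f\<in>{f. Poly_Mapping.keys f \<subseteq> B}. pm_push h (pm_push (inv_into A h) f) = f"
    using assms by (blast intro: pm_push_inverse[where A = B] bij_betw_inv_into_right)
  show "pm_push h ` {f. Poly_Mapping.keys f \<subseteq> A} \<subseteq> {f. Poly_Mapping.keys f \<subseteq> B}"
    using keys_pm_push_subset[of h] assms by (fastforce simp: bij_betw_def)
  show "pm_push (inv_into A h) ` {f. Poly_Mapping.keys f \<subseteq> B} \<subseteq> {f. Poly_Mapping.keys f \<subseteq> A}"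
    using keys_pm_push_subset[of "inv_into A h"] bij_betw_inv_into[OF assms]
    by (fastforce simp: bij_betw_def)
qed

section \<open>Supports and bilinear extensions\<close>

lemma keys_sum_subset:
  "(\<And>x. x \<in> A \<Longrightarrow> Poly_Mapping.keys (f x) \<subseteq> B) \<Longrightarrow> Poly_Mapping.keys (\<Sum>x\<in>A. f x) \<subseteq> B"
  using Poly_Mapping.keys_sum[of f A] by blast

lemma keys_bilinear_ext_subset:
  assumes "\<And>x y. x \<in> Poly_Mapping.keys f \<Longrightarrow> y \<in> Poly_Mapping.keys g \<Longrightarrow> h x y \<in> B"
  shows "Poly_Mapping.keys (bilinear_ext h f g) \<subseteq> B"
  unfolding bilinear_ext_def using assms by (intro keys_sum_subset) auto

lemma bilinear_ext_single [simp]: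
  "bilinear_ext h (Poly_Mapping.single x a) (Poly_Mapping.single y b) =
     Poly_Mapping.single (h x y) (a * b)"
  by (cases "a = 0"; cases "b = 0") (auto simp: bilinear_ext_def)

text \<open>By injectivity on the supports no terms merge, so the double sum on the right can be
  reindexed along \<open>h\<close>.\<close>

lemma pm_push_bilinear_ext:
  assumes "inj_on h (Poly_Mapping.keys f)" "inj_on h (Poly_Mapping.keys g)"
    and "\<And>x y. x \<in> Poly_Mapping.keys f \<Longrightarrow> y \<in> Poly_Mapping.keys g \<Longrightarrow>
           h (p x y) = q (h x) (h y)"
  shows "pm_push h (bilinear_ext p f g) = bilinear_ext q (pm_push h f) (pm_push h g)"
  using assms
  by (simp add: bilinear_ext_def pm_push_sum keys_pm_push_inj sum.reindex
      lookup_pm_push_inj[OF _ subset_refl])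


section \<open>Transport of quotients along isomorphisms\<close>

text \<open>The record type \<open>ns_operad\<close> imposes no axioms. Closure and nonemptiness are
  what makes \<open>sp P\<close> an ideal of itself and keeps results of operations inside the
  domain where an isomorphism can be inverted.\<close>

definition operad_closed :: "('k, 'a) ns_operad \<Rightarrow> bool" where
  "operad_closed P \<longleftrightarrow>
     (\<forall>n. sp P n \<noteq> {}) \<and>
     (\<forall>n. \<forall>x\<in>sp P n. \<forall>y\<in>sp P n. vadd P n x y \<in> sp P n) \<and>
     (\<forall>n c. \<forall>x\<in>sp P n. vscale P n c x \<in> sp P n) \<and>
     opunit P \<in> sp P 1 \<and>
     (\<forall>n m. \<forall>i\<in>{1..n}. \<forall>x\<in>sp P n. \<forall>y\<in>sp P m. pcomp P n m i x y \<in> sp P (n + m - 1))"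

text \<open>The improper ideal: it bounds the intersection in \<open>generated_ideal\<close> by
  \<open>sp P\<close> and keeps it from ranging over an empty family.\<close>

lemma operad_ideal_sp: "operad_closed P \<Longrightarrow> operad_ideal P (sp P)"
  by (auto simp: operad_closed_def operad_ideal_def)

text \<open>Since \<open>\<phi>\<close> is onto in each arity, the arbitrary factor in each
  composition condition has a preimage, and the condition is inherited from
  \<open>I\<close>.\<close>

lemma operad_ideal_image:
  assumes iso: "operad_isomorphism P Q \<phi>" and I: "operad_ideal P I"
  shows "operad_ideal Q (\<lambda>n. \<phi> n ` I n)"
proof -
  have sp: "sp Q n = \<phi> n ` sp P n" for n
    using iso by (auto simp: operad_isomorphism_def bij_betw_def)
  have sub: "x \<in> I n \<Longrightarrow> x \<in> sp P n" for x n
    using I by (auto simp: operad_ideal_def)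
  have add: "vadd Q n (\<phi> n x) (\<phi> n y) = \<phi> n (vadd P n x y)"
    if "x \<in> sp P n" "y \<in> sp P n" for n x y
    using iso that by (auto simp: operad_isomorphism_def)
  have scale: "vscale Q n c (\<phi> n x) = \<phi> n (vscale P n c x)" if "x \<in> sp P n" for n c x
    using iso that by (auto simp: operad_isomorphism_def)
  have comp: "pcomp Q n m i (\<phi> n x) (\<phi> m y) = \<phi> (n + m - 1) (pcomp P n m i x y)"
    if "i \<in> {1..n}" "x \<in> sp P n" "y \<in> sp P m" for n m i x y
    using iso that unfolding operad_isomorphism_def by metis
  have Iadd: "vadd P n x y \<in> I n" if "x \<in> I n" "y \<in> I n" for n x y
    using I that by (auto simp: operad_ideal_def)
  have Iscale: "vscale P n c x \<in> I n" if "x \<in> I n" for n c x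
    using I that by (auto simp: operad_ideal_def)
  have Il: "pcomp P n m i x y \<in> I (n + m - 1)" if "i \<in> {1..n}" "x \<in> I n" "y \<in> sp P m" for n m i x y
    using I that unfolding operad_ideal_def by metis
  have Ir: "pcomp P n m i x y \<in> I (n + m - 1)" if "i \<in> {1..n}" "x \<in> sp P n" "y \<in> I m" for n m i x y
    using I that unfolding operad_ideal_def by metis
  have ne: "I n \<noteq> {}" for n
    using I by (auto simp: operad_ideal_def)
  show ?thesis
    unfolding operad_ideal_def
  proof (intro conjI allI ballI)
    show "\<phi> n ` I n \<subseteq> sp Q n" for n
      by (auto simp: sp sub)
    show "\<phi> n ` I n \<noteq> {}" for n
      by (simp add: ne)
  next
    fix n x y assume "x \<in> \<phi> n ` I n" "y \<in> \<phi> n ` I n"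
    then show "vadd Q n x y \<in> \<phi> n ` I n"
      by (auto simp: add sub Iadd)
  next
    fix n c x assume "x \<in> \<phi> n ` I n"
    then show "vscale Q n c x \<in> \<phi> n ` I n"
      by (auto simp: scale sub Iscale)
  next
    fix n m i x y assume i: "i \<in> {1..n}" and "x \<in> \<phi> n ` I n" "y \<in> sp Q m"
    then obtain x' y' where "x' \<in> I n" "y' \<in> sp P m" "x = \<phi> n x'" "y = \<phi> m y'"
      by (auto simp: sp)
    with i show "pcomp Q n m i x y \<in> \<phi> (n + m - 1) ` I (n + m - 1)"
      using comp Il sub by blast
  next
    fix n m i x y assume i: "i \<in> {1..n}" and "x \<in> sp Q n" "y \<in> \<phi> m ` I m"
    then obtain x' y' where "x' \<in> sp P n" "y' \<in> I m" "x = \<phi> n x'" "y = \<phi> m y'"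
      by (auto simp: sp)
    with i show "pcomp Q n m i x y \<in> \<phi> (n + m - 1) ` I (n + m - 1)"
      using comp Ir sub by blast
  qed
qed

text \<open>\<open>inv_into\<close> inverts \<open>\<phi> n\<close> only on \<open>sp P n\<close>;
  closure of \<open>P\<close> guarantees that sums, multiples and compositions of preimages stay
  there.\<close>

lemma operad_isomorphism_inv_into:
  assumes iso: "operad_isomorphism P Q \<phi>" and P: "operad_closed P"
  shows "operad_isomorphism Q P (\<lambda>n. inv_into (sp P n) (\<phi> n))"
proof -
  let ?\<psi> = "\<lambda>n. inv_into (sp P n) (\<phi> n)"
  have bij: "bij_betw (\<phi> n) (sp P n) (sp Q n)" for n
    using iso by (auto simp: operad_isomorphism_def)
  have inv: "?\<psi> n (\<phi> n x) = x" if "x \<in> sp P n" for n x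
    using bij that by (rule bij_betw_inv_into_left)
  have sp: "sp Q n = \<phi> n ` sp P n" for n
    using bij by (auto simp: bij_betw_def)
  show ?thesis
    unfolding operad_isomorphism_def
  proof (intro conjI allI ballI)
    show "bij_betw (?\<psi> n) (sp Q n) (sp P n)" for n
      using bij by (rule bij_betw_inv_into)
    show "?\<psi> 1 (opunit Q) = opunit P"
      using iso P inv unfolding operad_isomorphism_def operad_closed_def by metis
  next
    fix n x y assume "x \<in> sp Q n" "y \<in> sp Q n"
    then obtain x' y' where x': "x' \<in> sp P n" "x = \<phi> n x'" and y': "y' \<in> sp P n" "y = \<phi> n y'"
      by (auto simp: sp)
    then have "vadd Q n x y = \<phi> n (vadd P n x' y')" "vadd P n x' y' \<in> sp P n"
      using iso P unfolding operad_isomorphism_def operad_closed_def by metis+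
    with x' y' show "?\<psi> n (vadd Q n x y) = vadd P n (?\<psi> n x) (?\<psi> n y)"
      by (simp add: inv)
  next
    fix n c x assume "x \<in> sp Q n"
    then obtain x' where x': "x' \<in> sp P n" "x = \<phi> n x'"
      by (auto simp: sp)
    then have "vscale Q n c x = \<phi> n (vscale P n c x')" "vscale P n c x' \<in> sp P n"
      using iso P unfolding operad_isomorphism_def operad_closed_def by metis+
    with x' show "?\<psi> n (vscale Q n c x) = vscale P n c (?\<psi> n x)"
      by (simp add: inv)
  next
    fix n m i x y assume i: "i \<in> {1..n}" and "x \<in> sp Q n" "y \<in> sp Q m"
    then obtain x' y' where x': "x' \<in> sp P n" "x = \<phi> n x'" and y': "y' \<in> sp P m" "y = \<phi> m y'"
      by (auto simp: sp)
    then have "pcomp Q n m i x y = \<phi> (n + m - 1) (pcomp P n m i x' y')"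
        "pcomp P n m i x' y' \<in> sp P (n + m - 1)"
      using iso P i unfolding operad_isomorphism_def operad_closed_def by metis+
    with x' y' show "?\<psi> (n + m - 1) (pcomp Q n m i x y) = pcomp P n m i (?\<psi> n x) (?\<psi> m y)"
      by (simp add: inv)
  qed
qed

lemma generated_ideal_subset_sp:
  assumes "operad_closed P" "R \<subseteq> sp P 3"
  shows "generated_ideal P R n \<subseteq> sp P n"
  using operad_ideal_sp[OF assms(1)] assms(2) by (auto simp: generated_ideal_def)

text \<open>Ideals of \<open>P\<close> containing \<open>R\<close> correspond to ideals of
  \<open>Q\<close> containing the image of \<open>R\<close>, so the two intersections
  correspond.\<close>

lemma generated_ideal_image:
  assumes iso: "operad_isomorphism P Q \<phi>" and P: "operad_closed P" and R: "R \<subseteq> sp P 3"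
  shows "generated_ideal Q (\<phi> 3 ` R) n = \<phi> n ` generated_ideal P R n"
proof
  let ?\<psi> = "\<lambda>n. inv_into (sp P n) (\<phi> n)"
  have bij: "bij_betw (\<phi> n) (sp P n) (sp Q n)" for n
    using iso by (auto simp: operad_isomorphism_def)
  have inv: "?\<psi> n (\<phi> n x) = x" if "x \<in> sp P n" for n x
    using bij that by (rule bij_betw_inv_into_left)
  have inv': "\<phi> n (?\<psi> n x) = x" if "x \<in> sp Q n" for n x
    using bij that by (rule bij_betw_inv_into_right)
  show "\<phi> n ` generated_ideal P R n \<subseteq> generated_ideal Q (\<phi> 3 ` R) n"
  proof safe
    fix x assume x: "x \<in> generated_ideal P R n"
    have "\<phi> n x \<in> J n" if J: "operad_ideal Q J" "\<phi> 3 ` R \<subseteq> J 3" for J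
    proof -
      \<comment> \<open>Pull \<open>J\<close> back along the inverse isomorphism to get an ideal of
        \<open>P\<close> that competes in the intersection containing \<open>x\<close>.\<close>
      have "operad_ideal P (\<lambda>n. ?\<psi> n ` J n)"
        by (rule operad_ideal_image[OF operad_isomorphism_inv_into[OF iso P] J(1)])
      moreover have "R \<subseteq> ?\<psi> 3 ` J 3"
      proof
        fix r assume "r \<in> R"
        then show "r \<in> ?\<psi> 3 ` J 3"
          using J(2) R inv[of r 3] by (metis image_eqI image_subset_iff subsetD)
      qed
      ultimately have "x \<in> ?\<psi> n ` J n"
        using x by (auto simp: generated_ideal_def)
      moreover have "J n \<subseteq> sp Q n"
        using J(1) by (auto simp: operad_ideal_def)
      ultimately show ?thesis
        using inv' by auto
    qed
    then show "\<phi> n x \<in> generated_ideal Q (\<phi> 3 ` R) n"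
      by (auto simp: generated_ideal_def)
  qed
  show "generated_ideal Q (\<phi> 3 ` R) n \<subseteq> \<phi> n ` generated_ideal P R n"
  proof
    fix y assume y: "y \<in> generated_ideal Q (\<phi> 3 ` R) n"
    have mem: "y \<in> \<phi> n ` I n" if "operad_ideal P I" "R \<subseteq> I 3" for I
    proof -
      have "\<phi> 3 ` R \<subseteq> \<phi> 3 ` I 3"
        using that(2) by (rule image_mono)
      then show ?thesis
        using y operad_ideal_image[OF iso that(1)] unfolding generated_ideal_def by blast
    qed
    \<comment> \<open>One preimage is fixed by means of the improper ideal; injectivity then shows
      that this same \<open>x\<close> lies in every competing \<open>I\<close>.\<close>
    obtain x where x: "x \<in> sp P n" "y = \<phi> n x"
      using mem[OF operad_ideal_sp[OF P] R] by auto
    have "x \<in> I n" if I: "operad_ideal P I" "R \<subseteq> I 3" for I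
    proof -
      obtain x' where "x' \<in> I n" "y = \<phi> n x'"
        using mem[OF I] by auto
      moreover have "I n \<subseteq> sp P n"
        using I(1) by (auto simp: operad_ideal_def)
      ultimately show ?thesis
        using x inv by (metis subsetD)
    qed
    then show "y \<in> \<phi> n ` generated_ideal P R n"
      using x by (auto simp: generated_ideal_def)
  qed
qed

text \<open>By additivity the direct image of the coset of \<open>x\<close> is the coset of
  \<open>\<phi> n x\<close>. The quotient operations are unions over all representatives, so they
  transport term by term and no representative has to be chosen.\<close>

lemma quotient_operad_isomorphism:
  assumes iso: "operad_isomorphism P Q \<phi>" and P: "operad_closed P"
    and I: "\<And>n. I n \<subseteq> sp P n" and J: "\<And>n. J n = \<phi> n ` I n"
  shows "operad_isomorphism (quotient_operad P I) (quotient_operad Q J) (\<lambda>n A. \<phi> n ` A)"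
proof -
  have bij: "bij_betw (\<phi> n) (sp P n) (sp Q n)" for n
    using iso by (auto simp: operad_isomorphism_def)
  have sp: "sp Q n = \<phi> n ` sp P n" for n
    using bij by (auto simp: bij_betw_def)
  have add: "\<phi> n (vadd P n x y) = vadd Q n (\<phi> n x) (\<phi> n y)"
    if "x \<in> sp P n" "y \<in> sp P n" for n x y
    using iso that by (auto simp: operad_isomorphism_def)
  have scale: "\<phi> n (vscale P n c x) = vscale Q n c (\<phi> n x)" if "x \<in> sp P n" for n c x
    using iso that by (auto simp: operad_isomorphism_def)
  have comp: "\<phi> (n + m - 1) (pcomp P n m i x y) = pcomp Q n m i (\<phi> n x) (\<phi> m y)"
    if "i \<in> {1..n}" "x \<in> sp P n" "y \<in> sp P m" for n m i x y
    using iso that unfolding operad_isomorphism_def by metis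
  have unit: "\<phi> 1 (opunit P) = opunit Q"
    using iso by (auto simp: operad_isomorphism_def)
  have Padd: "vadd P n x y \<in> sp P n" if "x \<in> sp P n" "y \<in> sp P n" for n x y
    using P that by (auto simp: operad_closed_def)
  have Pscale: "vscale P n c x \<in> sp P n" if "x \<in> sp P n" for n c x
    using P that by (auto simp: operad_closed_def)
  have Pcomp: "pcomp P n m i x y \<in> sp P (n + m - 1)"
    if "i \<in> {1..n}" "x \<in> sp P n" "y \<in> sp P m" for n m i x y
    using P that unfolding operad_closed_def by metis
  have Punit: "opunit P \<in> sp P 1"
    using P by (auto simp: operad_closed_def)
  have coset: "\<phi> n ` operad_coset P I n x = operad_coset Q J n (\<phi> n x)" if "x \<in> sp P n" for n x
    unfolding operad_coset_def J image_image
    by (rule image_cong) (use that I in \<open>auto simp: add subset_iff\<close>)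
  have sub: "A \<subseteq> sp P n" if "A \<in> operad_coset P I n ` sp P n" for A n
    using that I by (auto simp: operad_coset_def intro!: Padd)
  show ?thesis
    unfolding operad_isomorphism_def quotient_operad_def ns_operad.simps
  proof (intro conjI allI ballI)
    fix n
    \<comment> \<open>Cosets are subsets of \<open>sp P n\<close>, where \<open>\<phi> n\<close> is
      injective, so they are determined by their images.\<close>
    have "inj_on ((`) (\<phi> n)) (operad_coset P I n ` sp P n)"
      by (rule inj_onI) (metis sub bij bij_betw_def inj_on_image_eq_iff)
    moreover have "(`) (\<phi> n) ` operad_coset P I n ` sp P n = operad_coset Q J n ` sp Q n"
      unfolding sp image_image by (rule image_cong) (auto simp: coset)
    ultimately show "bij_betw ((`) (\<phi> n)) (operad_coset P I n ` sp P n)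
        (operad_coset Q J n ` sp Q n)"
      by (simp add: bij_betw_def)
  next
    show "\<phi> 1 ` operad_coset P I 1 (opunit P) = operad_coset Q J 1 (opunit Q)"
      using coset[OF Punit] unit by simp
  next
    fix n A B assume "A \<in> operad_coset P I n ` sp P n" "B \<in> operad_coset P I n ` sp P n"
    then have "A \<subseteq> sp P n" "B \<subseteq> sp P n"
      by (simp_all add: sub)
    then show "\<phi> n ` (\<Union>a\<in>A. \<Union>b\<in>B. operad_coset P I n (vadd P n a b)) =
        (\<Union>a\<in>\<phi> n ` A. \<Union>b\<in>\<phi> n ` B. operad_coset Q J n (vadd Q n a b))"
      unfolding image_UN UN_simps
      by (intro SUP_cong refl) (auto simp: coset Padd add subset_iff)
  next
    fix n c A assume "A \<in> operad_coset P I n ` sp P n"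
    then have "A \<subseteq> sp P n"
      by (simp_all add: sub)
    then show "\<phi> n ` (\<Union>a\<in>A. operad_coset P I n (vscale P n c a)) =
        (\<Union>a\<in>\<phi> n ` A. operad_coset Q J n (vscale Q n c a))"
      unfolding image_UN UN_simps
      by (intro SUP_cong refl) (auto simp: coset Pscale scale subset_iff)
  next
    fix n m i A B assume i: "i \<in> {1..n}"
      and "A \<in> operad_coset P I n ` sp P n" "B \<in> operad_coset P I m ` sp P m"
    then have "A \<subseteq> sp P n" "B \<subseteq> sp P m"
      by (simp_all add: sub)
    with i have "\<phi> (n + m - 1) ` operad_coset P I (n + m - 1) (pcomp P n m i a b) =
        operad_coset Q J (n + m - 1) (pcomp Q n m i (\<phi> n a) (\<phi> m b))" if "a \<in> A" "b \<in> B" for a b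
      using that coset[OF Pcomp] comp by (metis subsetD)
    then show "\<phi> (n + m - 1) ` (\<Union>a\<in>A. \<Union>b\<in>B. operad_coset P I (n + m - 1) (pcomp P n m i a b)) =
        (\<Union>a\<in>\<phi> n ` A. \<Union>b\<in>\<phi> m ` B. operad_coset Q J (n + m - 1) (pcomp Q n m i a b))"
      unfolding image_UN UN_simps
      by (intro SUP_cong refl)
  qed
qed


section \<open>Renaming the generators of a free operad\<close>

lemma operad_of_basis_isomorphism:
  fixes B :: "nat \<Rightarrow> 'b set" and C :: "nat \<Rightarrow> 'c set"
  assumes "\<And>n. bij_betw h (B n) (C n)" and "h u = u'"
    and "\<And>i x y. h (p i x y) = q i (h x) (h y)"
  shows "operad_isomorphism (operad_of_basis B u p :: ('k::field, _) ns_operad)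
           (operad_of_basis C u' q) (\<lambda>n. pm_push h)"
proof -
  \<comment> \<open>\<open>h\<close> is known to be injective only within one arity; the support of
    a homogeneous element lies there.\<close>
  have inj: "inj_on h (Poly_Mapping.keys f)" if "Poly_Mapping.keys f \<subseteq> B n"
    for f :: "'b \<Rightarrow>\<^sub>0 'k" and n
    using assms(1) that by (metis bij_betw_def inj_on_subset)
  show ?thesis
    unfolding operad_isomorphism_def operad_of_basis_def ns_operad.simps
    using assms inj
    by (auto simp: bij_betw_pm_push pm_push_add pm_push_scale intro!: pm_push_bilinear_ext)
qed

lemma size1_graft: "1 \<le> i \<Longrightarrow> i \<le> size1 t \<Longrightarrow> size1 (graft t i s) = size1 t + size1 s - 1"
  by (induction t i s rule: graft.induct) auto

lemma set_tree_graft: "set_tree (graft t i s) \<subseteq> set_tree t \<union> set_tree s"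
  by (induction t i s rule: graft.induct) auto

lemma map_tree_graft: "map_tree h (graft t i s) = graft (map_tree h t) i (map_tree h s)"
  by (induction t i s rule: graft.induct) auto

lemma sp_free_operad:
  "sp (free_operad G) n = {f. Poly_Mapping.keys f \<subseteq> {t. size1 t = n \<and> set_tree t \<subseteq> G}}"
  by (simp add: free_operad_def operad_of_basis_def)

lemma operad_closed_free_operad: "operad_closed (free_operad G :: ('k::field, _) ns_operad)"
  unfolding operad_closed_def sp_free_operad
  unfolding free_operad_def operad_of_basis_def ns_operad.simps
proof (intro conjI allI ballI)
  show "{f :: _ \<Rightarrow>\<^sub>0 'k. Poly_Mapping.keys f \<subseteq> {t. size1 t = n \<and> set_tree t \<subseteq> G}} \<noteq> {}" for n
    by (auto intro!: exI[of _ 0])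
next
  fix n and f g :: "'a tree \<Rightarrow>\<^sub>0 'k"
  assume "f \<in> {f. Poly_Mapping.keys f \<subseteq> {t. size1 t = n \<and> set_tree t \<subseteq> G}}"
    "g \<in> {f. Poly_Mapping.keys f \<subseteq> {t. size1 t = n \<and> set_tree t \<subseteq> G}}"
  then show "f + g \<in> {f. Poly_Mapping.keys f \<subseteq> {t. size1 t = n \<and> set_tree t \<subseteq> G}}"
    using Poly_Mapping.keys_add[of f g] by blast
next
  fix n c and f :: "'a tree \<Rightarrow>\<^sub>0 'k"
  assume "f \<in> {f. Poly_Mapping.keys f \<subseteq> {t. size1 t = n \<and> set_tree t \<subseteq> G}}"
  then show "pm_scale c f \<in> {f. Poly_Mapping.keys f \<subseteq> {t. size1 t = n \<and> set_tree t \<subseteq> G}}"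
    using keys_pm_scale_subset[of c f] by blast
next
  show "Poly_Mapping.single \<langle>\<rangle> (1::'k) \<in> {f. Poly_Mapping.keys f \<subseteq> {t. size1 t = 1 \<and> set_tree t \<subseteq> G}}"
    by simp
next
  fix n m i and f g :: "'a tree \<Rightarrow>\<^sub>0 'k"
  assume "i \<in> {1..n}" "f \<in> {f. Poly_Mapping.keys f \<subseteq> {t. size1 t = n \<and> set_tree t \<subseteq> G}}"
    "g \<in> {f. Poly_Mapping.keys f \<subseteq> {t. size1 t = m \<and> set_tree t \<subseteq> G}}"
  then have "Poly_Mapping.keys (bilinear_ext (\<lambda>s t. graft s i t) f g)
      \<subseteq> {t. size1 t = n + m - 1 \<and> set_tree t \<subseteq> G}"
    using set_tree_graft by (intro keys_bilinear_ext_subset) (fastforce simp: size1_graft)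
  then show "bilinear_ext (\<lambda>s t. graft s i t) f g
      \<in> {f. Poly_Mapping.keys f \<subseteq> {t. size1 t = n + m - 1 \<and> set_tree t \<subseteq> G}}"
    by simp
qed

lemma bij_betw_map_tree:
  assumes "bij_betw h G H"
  shows "bij_betw (map_tree h) {t. size1 t = n \<and> set_tree t \<subseteq> G} {t. size1 t = n \<and> set_tree t \<subseteq> H}"
proof (rule bij_betw_byWitness[where f' = "map_tree (inv_into G h)"])
  have inverse: "map_tree v (map_tree u t) = t"
    if "set_tree t \<subseteq> A" "\<And>x. x \<in> A \<Longrightarrow> v (u x) = x" for t :: "'x tree" and u :: "'x \<Rightarrow> 'y" and v A
    using that by (induction t) auto
  show "\<forall>t\<in>{t. size1 t = n \<and> set_tree t \<subseteq> G}. map_tree (inv_into G h) (map_tree h t) = t"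
    using assms by (auto intro!: inverse[of _ G] simp: bij_betw_inv_into_left)
  show "\<forall>t\<in>{t. size1 t = n \<and> set_tree t \<subseteq> H}. map_tree h (map_tree (inv_into G h) t) = t"
    using assms by (auto intro!: inverse[of _ H] simp: bij_betw_inv_into_right)
  show "map_tree h ` {t. size1 t = n \<and> set_tree t \<subseteq> G} \<subseteq> {t. size1 t = n \<and> set_tree t \<subseteq> H}"
    using assms by (fastforce simp: tree.set_map bij_betw_def)
  show "map_tree (inv_into G h) ` {t. size1 t = n \<and> set_tree t \<subseteq> H}
      \<subseteq> {t. size1 t = n \<and> set_tree t \<subseteq> G}"
    using bij_betw_inv_into[OF assms] by (fastforce simp: tree.set_map bij_betw_def)
qed

lemma free_operad_isomorphism:
  assumes "bij_betw h G H"
  shows "operad_isomorphism (free_operad G :: ('k::field, _) ns_operad) (free_operad H)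
           (\<lambda>n. pm_push (map_tree h))"
  unfolding free_operad_def
  by (rule operad_of_basis_isomorphism) (simp_all add: bij_betw_map_tree[OF assms] map_tree_graft)

text \<open>Renaming generators gives an isomorphism of free operads. It carries generated ideal to
  generated ideal, hence descends to the quotients.\<close>

lemma admits_presentation_rename:
  fixes R :: "('g tree \<Rightarrow>\<^sub>0 'k::field) set"
  assumes h: "bij_betw h G H" and R: "R \<subseteq> sp (free_operad G :: ('k, _) ns_operad) 3"
  shows "admits_presentation (presented_operad G R) H (pm_push (map_tree h) ` R)"
proof -
  note iso = free_operad_isomorphism[OF h, where 'k = 'k]
  have "pm_push (map_tree h) ` R \<subseteq> sp (free_operad H :: ('k, _) ns_operad) 3"
    using iso R by (fastforce simp: operad_isomorphism_def bij_betw_def)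
  then show ?thesis
    unfolding admits_presentation_def operad_isomorphic_def presented_operad_def
    using quotient_operad_isomorphism[OF iso operad_closed_free_operad
        generated_ideal_subset_sp[OF operad_closed_free_operad R]
        generated_ideal_image[OF iso operad_closed_free_operad R]]
    by blast
qed


section \<open>The annihilator of the kernel of a map on trees\<close>

text \<open>\<open>Suc 0\<close> rather than \<open>1\<close>, because this is the form to which the
  simplifier brings the index.\<close>

lemma gen_comp_1: "gen_comp (Suc 0) x y = Node (Node Leaf y Leaf) x Leaf"
  and gen_comp_2: "gen_comp 2 x y = Node Leaf x (Node Leaf y Leaf)"
  by (simp_all add: gen_comp_def corolla_def)

definition quad_trees :: "'g set \<Rightarrow> 'g tree set" where
  "quad_trees G = {t. size1 t = 3 \<and> set_tree t \<subseteq> G}"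

text \<open>Three leaves split at the root as 2 + 1 or 1 + 2, giving the two shapes of the tree
  basis of arity 3.\<close>

lemma quad_trees_eq:
  "quad_trees G = (\<lambda>(x, y). gen_comp 1 x y) ` (G \<times> G) \<union> (\<lambda>(x, y). gen_comp 2 x y) ` (G \<times> G)"
    (is "_ = ?B")
proof
  have size1_1: "size1 t = 1 \<Longrightarrow> t = Leaf" for t :: "'g tree"
    by (cases t) (auto simp: size1_size)
  have size1_2: "size1 t = 2 \<Longrightarrow> \<exists>x. t = Node Leaf x Leaf" for t :: "'g tree"
  proof (cases t)
    case (Node l x r)
    assume "size1 t = 2"
    then have "size1 l + size1 r = 2" "size1 l > 0" "size1 r > 0"
      using Node by auto
    then have "size1 l = 1" "size1 r = 1"
      by linarith+
    then show ?thesis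
      using Node size1_1 by blast
  qed simp
  show "quad_trees G \<subseteq> ?B"
  proof
    fix t assume t: "t \<in> quad_trees G"
    then obtain l x r where lxr: "t = Node l x r"
      by (cases t) (auto simp: quad_trees_def)
    then have "size1 l + size1 r = 3" "size1 l > 0" "size1 r > 0"
      using t by (auto simp: quad_trees_def)
    then have "size1 l = 1 \<and> size1 r = 2 \<or> size1 l = 2 \<and> size1 r = 1"
      by linarith
    then consider y where "l = Leaf" "r = Node Leaf y Leaf" | y where "l = Node Leaf y Leaf" "r = Leaf"
      using size1_1 size1_2 by blast
    then show "t \<in> ?B"
      using t lxr by cases (auto simp: quad_trees_def gen_comp_1 gen_comp_2)
  qed
  show "?B \<subseteq> quad_trees G"
    by (auto simp: quad_trees_def gen_comp_1 gen_comp_2)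
qed

lemma finite_quad_trees: "finite G \<Longrightarrow> finite (quad_trees G)"
  by (simp add: quad_trees_eq)

text \<open>The Koszul form is diagonal in the tree basis; this is its diagonal entry, 0 on trees
  that are not of the form \<open>gen_comp 1 x y\<close> or \<open>gen_comp 2 x y\<close>.\<close>

definition tree_sign :: "'g tree \<Rightarrow> 'k::field" where
  "tree_sign t = tree_form t t"

lemma tree_form_eq: "tree_form s t = (tree_sign t when s = t)"
  by (auto simp: tree_sign_def tree_form_def when_def)

lemma tree_sign_gen_comp [simp]: "tree_sign (gen_comp (Suc 0) x y) = 1" "tree_sign (gen_comp 2 x y) = - 1"
  by (auto simp: tree_sign_def tree_form_def gen_comp_1 gen_comp_2)

lemma tree_sign_square: "t \<in> quad_trees G \<Longrightarrow> tree_sign t * tree_sign t = 1"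
  by (auto simp: quad_trees_eq)

text \<open>Diagonality collapses the double sum. The index set does not depend on \<open>g\<close>,
  so linearity in \<open>g\<close> becomes visible.\<close>

lemma koszul_form_eq:
  assumes "finite A" "Poly_Mapping.keys f \<subseteq> A"
  shows "koszul_form f g =
    (\<Sum>t\<in>A. Poly_Mapping.lookup f t * Poly_Mapping.lookup g t * tree_sign t)"
proof -
  have "koszul_form f g = (\<Sum>s\<in>Poly_Mapping.keys f. \<Sum>t\<in>Poly_Mapping.keys g.
      if t = s then Poly_Mapping.lookup f s * Poly_Mapping.lookup g s * tree_sign s else 0)"
    unfolding koszul_form_def by (intro sum.cong refl) (auto simp: tree_form_eq)
  also have "\<dots> = (\<Sum>s\<in>Poly_Mapping.keys f.
      Poly_Mapping.lookup f s * Poly_Mapping.lookup g s * tree_sign s)"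
    by (intro sum.cong refl) (auto simp: in_keys_iff)
  also have "\<dots> = (\<Sum>t\<in>A. Poly_Mapping.lookup f t * Poly_Mapping.lookup g t * tree_sign t)"
    by (rule sum.mono_neutral_left) (use assms in \<open>auto simp: in_keys_iff\<close>)
  finally show ?thesis .
qed

text \<open>For finite \<open>G\<close>, pairing with this element reads off the coefficient of
  \<open>w\<close> in \<open>pm_push v r\<close>, for \<open>r\<close> supported on
  \<open>quad_trees G\<close>: its signs cancel those of the form.\<close>

definition signed_fibre_sum :: "'g set \<Rightarrow> ('g tree \<Rightarrow> 'w) \<Rightarrow> 'w \<Rightarrow> ('g tree \<Rightarrow>\<^sub>0 'k::field)" where
  "signed_fibre_sum G v w =
     (\<Sum>t\<in>{t \<in> quad_trees G. v t = w}. Poly_Mapping.single t (tree_sign t))"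

lemma lookup_signed_fibre_sum:
  assumes "finite G" "t \<in> quad_trees G"
  shows "Poly_Mapping.lookup (signed_fibre_sum G v w) t = (tree_sign t when v t = w)"
  using assms finite_quad_trees[OF assms(1)]
  by (auto simp: signed_fibre_sum_def lookup_sum lookup_single when_def)

lemma keys_signed_fibre_sum: "Poly_Mapping.keys (signed_fibre_sum G v w) \<subseteq> quad_trees G"
  unfolding signed_fibre_sum_def by (intro keys_sum_subset) auto

text \<open>
  A combination of trees lies in the kernel iff its coefficients sum to zero on every fibre of \<open>v\<close>,
  so it is orthogonal to the kernel iff its sign-twisted coefficients are constant on the fibres.
\<close>

lemma annihilator_kernel:
  fixes G :: "'g set" and v :: "'g tree \<Rightarrow> 'w"
  assumes "finite G"
  shows "annihilator G {f \<in> sp (free_operad G) 3. pm_push v f = 0} =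
    (pm.span (signed_fibre_sum G v ` v ` quad_trees G) :: ('g tree \<Rightarrow>\<^sub>0 'k::field) set)"
    (is "annihilator G ?R = pm.span ?S")
proof
  let ?B = "quad_trees G"
  have fin: "finite ?B"
    using assms by (rule finite_quad_trees)
  have sp: "sp (free_operad G) 3 = {f :: _ \<Rightarrow>\<^sub>0 'k. Poly_Mapping.keys f \<subseteq> ?B}"
    by (simp add: sp_free_operad quad_trees_def)
  show "annihilator G ?R \<subseteq> pm.span ?S"
  proof
    fix f :: "'g tree \<Rightarrow>\<^sub>0 'k" assume f: "f \<in> annihilator G ?R"
    then have keys: "Poly_Mapping.keys f \<subseteq> ?B"
      by (simp add: annihilator_def sp)
    have const: "Poly_Mapping.lookup f s * tree_sign s = Poly_Mapping.lookup f t * tree_sign t"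
      if st: "s \<in> ?B" "t \<in> ?B" "v s = v t" for s t
    proof -
      \<comment> \<open>Test element: two trees with equal value differ by a kernel element, and
        pairing with it compares their twisted coefficients.\<close>
      let ?r = "Poly_Mapping.single s 1 - Poly_Mapping.single t 1 :: 'g tree \<Rightarrow>\<^sub>0 'k"
      have kr: "Poly_Mapping.keys ?r \<subseteq> ?B"
        using keys_diff[of "Poly_Mapping.single s 1" "Poly_Mapping.single t (1::'k)"] st by auto
      then have "?r \<in> ?R"
        using st by (simp add: sp pm_push_diff)
      then have "koszul_form ?r f = 0"
        using f by (simp add: annihilator_def)
      then have "(\<Sum>x\<in>?B. Poly_Mapping.lookup ?r x * Poly_Mapping.lookup f x * tree_sign x) = 0"
        by (simp add: koszul_form_eq[OF fin kr])
      moreover have "(\<Sum>x\<in>?B. Poly_Mapping.lookup ?r x * Poly_Mapping.lookup f x * tree_sign x) =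
          (\<Sum>x\<in>?B. if x = s then Poly_Mapping.lookup f x * tree_sign x else 0) -
          (\<Sum>x\<in>?B. if x = t then Poly_Mapping.lookup f x * tree_sign x else 0)"
        unfolding sum_subtractf[symmetric]
        by (intro sum.cong refl) (auto simp: lookup_minus lookup_single when_def)
      ultimately show ?thesis
        using st fin by simp
    qed
    \<comment> \<open>One tree per fibre; by \<open>const\<close> the twisted coefficient at
      \<open>rep w\<close> is the common value on the whole fibre.\<close>
    define rep where "rep w = inv_into ?B v w" for w
    have rep: "rep w \<in> ?B" "v (rep w) = w" if "w \<in> v ` ?B" for w
      using that by (auto simp: rep_def inv_into_into f_inv_into_f)
    define c where "c w = Poly_Mapping.lookup f (rep w) * tree_sign (rep w)" for w
    have "f = (\<Sum>w\<in>v ` ?B. pm_scale (c w) (signed_fibre_sum G v w))"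
    proof (rule poly_mapping_eqI)
      fix t
      show "Poly_Mapping.lookup f t =
        Poly_Mapping.lookup (\<Sum>w\<in>v ` ?B. pm_scale (c w) (signed_fibre_sum G v w)) t"
      proof (cases "t \<in> ?B")
        case True
        \<comment> \<open>The fibres are disjoint, so only the summand for \<open>v t\<close> sees
          \<open>t\<close>; multiplying by the sign again undoes the twist.\<close>
        then have "Poly_Mapping.lookup (\<Sum>w\<in>v ` ?B. pm_scale (c w) (signed_fibre_sum G v w)) t
            = (\<Sum>w\<in>v ` ?B. if w = v t then c w * tree_sign t else 0)"
          by (simp add: lookup_sum lookup_signed_fibre_sum[OF assms] when_def if_distrib eq_commute
              cong: if_cong)
        also have "\<dots> = c (v t) * tree_sign t"
          using fin True by simp
        also have "\<dots> = Poly_Mapping.lookup f t * (tree_sign t * tree_sign t)"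
          using const[of "rep (v t)" t] rep True by (simp add: c_def)
        finally show ?thesis
          by (simp add: tree_sign_square[OF True])
      next
        case False
        then have "Poly_Mapping.lookup (signed_fibre_sum G v w) t = (0::'k)" for w
          using keys_signed_fibre_sum[of G v w] by (auto simp: in_keys_iff)
        moreover have "Poly_Mapping.lookup f t = 0"
          using False keys by (auto simp: in_keys_iff)
        ultimately show ?thesis
          by (simp add: lookup_sum)
      qed
    qed
    also have "\<dots> \<in> pm.span ?S"
      by (intro pm.span_sum pm.span_scale pm.span_base imageI)
    finally show "f \<in> pm.span ?S" .
  qed
  show "pm.span ?S \<subseteq> annihilator G ?R"
  proof (rule pm.span_minimal)
    show "?S \<subseteq> annihilator G ?R"
    proof safe
      fix s assume "s \<in> ?B"
      have "koszul_form r (signed_fibre_sum G v w) = 0" if "r \<in> ?R" for r :: "'g tree \<Rightarrow>\<^sub>0 'k" and w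
      proof -
        have kr: "Poly_Mapping.keys r \<subseteq> ?B" and r0: "pm_push v r = 0"
          using that by (auto simp: sp)
        \<comment> \<open>The sign of the form meets the sign of the fibre sum. What remains is a
          coefficient of \<open>pm_push v r\<close>, which is 0.\<close>
        have "koszul_form r (signed_fibre_sum G v w) =
            (\<Sum>t\<in>?B. Poly_Mapping.lookup r t * (tree_sign t * tree_sign t) when v t = w)"
          unfolding koszul_form_eq[OF fin kr]
          by (intro sum.cong refl) (auto simp: lookup_signed_fibre_sum[OF assms] when_def)
        also have "\<dots> = (\<Sum>t\<in>?B. Poly_Mapping.lookup r t when v t = w)"
          by (intro sum.cong refl) (simp add: tree_sign_square)
        also have "\<dots> = Poly_Mapping.lookup (pm_push v r) w"
          by (simp add: pm_push_superset[OF fin kr] lookup_sum lookup_single)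
        finally show ?thesis
          by (simp add: r0)
      qed
      then show "signed_fibre_sum G v (v s) \<in> annihilator G ?R"
        using keys_signed_fibre_sum[of G v "v s"] by (auto simp: annihilator_def sp)
    qed
    show "pm.subspace (annihilator G ?R)"
    proof (rule pm.subspaceI)
      show "0 \<in> annihilator G ?R"
        by (simp add: annihilator_def sp koszul_form_def)
    next
      fix f g :: "'g tree \<Rightarrow>\<^sub>0 'k" assume "f \<in> annihilator G ?R" "g \<in> annihilator G ?R"
      then show "f + g \<in> annihilator G ?R"
        using Poly_Mapping.keys_add[of f g]
        by (auto simp: annihilator_def sp koszul_form_eq[OF fin] lookup_add algebra_simps sum.distrib)
    next
      fix c and f :: "'g tree \<Rightarrow>\<^sub>0 'k" assume f: "f \<in> annihilator G ?R"
      have "koszul_form r (pm_scale c f) = c * koszul_form r f" if "r \<in> ?R" for r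
        using that by (auto simp: sp koszul_form_eq[OF fin] sum_distrib_left algebra_simps)
      then show "pm_scale c f \<in> annihilator G ?R"
        using f keys_pm_scale_subset[of c f] by (auto simp: annihilator_def sp)
    qed
  qed
qed


section \<open>Evaluation of trees in \<open>Dias\<close>\<close>

fun dias_word :: "nat list tree \<Rightarrow> nat list" where
  "dias_word Leaf = [0]"
| "dias_word (Node l g r) = dias_comp 1 (dias_comp 2 g (dias_word r)) (dias_word l)"

text \<open>A composition of basis words is again one word with coefficient 1, so no genuine linear
  combination ever arises.\<close>

lemma operad_eval_Dias:
  "operad_eval (Dias \<gamma> :: ('k::field_char_0, _) ns_operad) (\<lambda>w. Poly_Mapping.single w 1) t =
     Poly_Mapping.single (dias_word t) 1"
  by (induction t) (simp_all add: Dias_def operad_of_basis_def)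

text \<open>This presents \<open>dias_relations\<close> as the kernel of a pushed map on trees, as
  \<open>annihilator_kernel\<close> requires.\<close>

lemma dias_canonical_eq: "dias_canonical \<gamma> = pm_push dias_word"
  by (rule ext) (simp add: dias_canonical_def pm_push_def operad_eval_Dias)

lemma dias_gens_eq: "dias_gens \<gamma> = (\<lambda>a. [0, a]) ` {1..\<gamma>} \<union> (\<lambda>a. [a, 0]) ` {1..\<gamma>}"
proof
  show "dias_gens \<gamma> \<subseteq> (\<lambda>a. [0, a]) ` {1..\<gamma>} \<union> (\<lambda>a. [a, 0]) ` {1..\<gamma>}"
  proof
    fix w assume w: "w \<in> dias_gens \<gamma>"
    then obtain p q where "w = [p, q]"
      by (auto simp: dias_gens_def dias_words_def length_Suc_conv numeral_2_eq_2)
    then show "w \<in> (\<lambda>a. [0, a]) ` {1..\<gamma>} \<union> (\<lambda>a. [a, 0]) ` {1..\<gamma>}"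
      using w by (auto simp: dias_gens_def dias_words_def split: if_splits)
  qed
qed (auto simp: dias_gens_def dias_words_def)

lemma dias_word_gen_comp:
  "dias_word (gen_comp (Suc 0) [p, q] [r, s]) = [max p r, max p s, q]"
  "dias_word (gen_comp 2 [p, q] [r, s]) = [p, max q r, max q s]"
  by (simp_all add: gen_comp_1 gen_comp_2 dias_comp_def)

lemma gen_comp_eq_iff [simp]:
  "gen_comp (Suc 0) x y = gen_comp (Suc 0) x' y' \<longleftrightarrow> x = x' \<and> y = y'"
  "gen_comp 2 x y = gen_comp 2 x' y' \<longleftrightarrow> x = x' \<and> y = y'"
  "gen_comp (Suc 0) x y \<noteq> gen_comp 2 x' y'"
  "gen_comp 2 x y \<noteq> gen_comp (Suc 0) x' y'"
  by (auto simp: gen_comp_1 gen_comp_2)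

text \<open>On words of length 2 with exactly one zero, the first letter decides on which side the
  zero stands.\<close>

definition harpoon :: "nat list \<Rightarrow> dendr_gen" where
  "harpoon w = (if w ! 0 = 0 then Lharp (w ! 1) else Rharp (w ! 0))"

lemma harpoon_simps: "harpoon [0, a] = Lharp a" "0 < a \<Longrightarrow> harpoon [a, 0] = Rharp a"
  by (simp_all add: harpoon_def)

lemma bij_betw_harpoon: "bij_betw harpoon (dias_gens \<gamma>) (dendr_gens \<gamma>)"
  unfolding bij_betw_def
proof
  show "inj_on harpoon (dias_gens \<gamma>)"
    by (rule inj_onI) (auto simp: dias_gens_eq harpoon_simps)
  show "harpoon ` dias_gens \<gamma> = dendr_gens \<gamma>"
    unfolding dias_gens_eq dendr_gens_def image_Un image_image
    by (intro arg_cong2[where f = "(\<union>)"] image_cong) (auto simp: harpoon_simps)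
qed

text \<open>Reduces the computation of fibres to eight shapes and arithmetic with
  \<open>max\<close>.\<close>

lemma quad_trees_dias_gens_iff:
  "t \<in> quad_trees (dias_gens \<gamma>) \<longleftrightarrow> (\<exists>a\<in>{1..\<gamma>}. \<exists>b\<in>{1..\<gamma>}.
     t = gen_comp 1 [0, a] [0, b] \<or> t = gen_comp 1 [0, a] [b, 0] \<or>
     t = gen_comp 1 [a, 0] [0, b] \<or> t = gen_comp 1 [a, 0] [b, 0] \<or>
     t = gen_comp 2 [0, a] [0, b] \<or> t = gen_comp 2 [0, a] [b, 0] \<or>
     t = gen_comp 2 [a, 0] [0, b] \<or> t = gen_comp 2 [a, 0] [b, 0])"
proof -
  have "t \<in> quad_trees (dias_gens \<gamma>) \<longleftrightarrow>
      (\<exists>x\<in>dias_gens \<gamma>. \<exists>y\<in>dias_gens \<gamma>. t = gen_comp 1 x y \<or> t = gen_comp 2 x y)"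
    unfolding quad_trees_eq by auto
  moreover have "(\<exists>x\<in>dias_gens \<gamma>. P x) \<longleftrightarrow> (\<exists>a\<in>{1..\<gamma>}. P [0, a] \<or> P [a, 0])" for P
    unfolding dias_gens_eq by blast
  ultimately show ?thesis
    by (simp only: bex_disj_distrib disj_ac)
qed

section \<open>Fibres of the evaluation in arity 3\<close>

abbreviation dias_fibre :: "nat \<Rightarrow> nat list \<Rightarrow> nat list tree set" where
  "dias_fibre \<gamma> w \<equiv> {t \<in> quad_trees (dias_gens \<gamma>). dias_word t = w}"

text \<open>A zero in the middle forces every \<open>max\<close> to be taken with 0, so both letters
  survive and each shape occurs once.\<close>

lemma dias_fibre_middle:
  assumes "a \<in> {1..\<gamma>}" "b \<in> {1..\<gamma>}"
  shows "dias_fibre \<gamma> [b, 0, a] = {gen_comp 1 [0, a] [b, 0], gen_comp 2 [b, 0] [0, a]}"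
  using assms by (auto simp: quad_trees_dias_gens_iff dias_word_gen_comp)

text \<open>In \<open>[0, q] \<circ>\<^sub>2 y\<close> both new letters are at least
  \<open>q\<close> and one equals \<open>q\<close>. So the smaller letter labels the root, the
  larger one comes from \<open>y\<close>, and its position decides between \<open>[0, b]\<close> and
  \<open>[b, 0]\<close>.\<close>

lemma dias_fibre_left_less:
  assumes "a \<in> {1..\<gamma>}" "b \<in> {1..\<gamma>}" "a < b"
  shows "dias_fibre \<gamma> [0, a, b] = {gen_comp 1 [0, b] [0, a], gen_comp 2 [0, a] [0, b]}"
  using assms
  by (auto simp: quad_trees_dias_gens_iff dias_word_gen_comp max_def split: if_splits)

lemma dias_fibre_left_greater:
  assumes "a \<in> {1..\<gamma>}" "b \<in> {1..\<gamma>}" "a < b"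
  shows "dias_fibre \<gamma> [0, b, a] = {gen_comp 1 [0, a] [0, b], gen_comp 2 [0, a] [b, 0]}"
  using assms
  by (auto simp: quad_trees_dias_gens_iff dias_word_gen_comp max_def split: if_splits)

text \<open>With equal letters the inserted letter is absorbed: any \<open>c \<le> d\<close> on
  either side disappears in \<open>max d c\<close>. This is the origin of the sums over
  \<open>{1..d}\<close>.\<close>

lemma dias_fibre_left_equal:
  assumes "d \<in> {1..\<gamma>}"
  shows "dias_fibre \<gamma> [0, d, d] = insert (gen_comp 1 [0, d] [0, d])
    ((\<lambda>c. gen_comp 2 [0, d] [0, c]) ` {1..d} \<union> (\<lambda>c. gen_comp 2 [0, d] [c, 0]) ` {1..d})"
  using assms
  by (auto simp: quad_trees_dias_gens_iff dias_word_gen_comp max_def split: if_splits)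

text \<open>This and the next two fibres mirror those with the zero on the left: reversing words
  exchanges \<open>\<circ>\<^sub>1\<close> and \<open>\<circ>\<^sub>2\<close>.\<close>

lemma dias_fibre_right_less:
  assumes "a \<in> {1..\<gamma>}" "b \<in> {1..\<gamma>}" "a < b"
  shows "dias_fibre \<gamma> [a, b, 0] = {gen_comp 1 [a, 0] [0, b], gen_comp 2 [a, 0] [b, 0]}"
  using assms
  by (auto simp: quad_trees_dias_gens_iff dias_word_gen_comp max_def split: if_splits)

lemma dias_fibre_right_greater:
  assumes "a \<in> {1..\<gamma>}" "b \<in> {1..\<gamma>}" "a < b"
  shows "dias_fibre \<gamma> [b, a, 0] = {gen_comp 1 [a, 0] [b, 0], gen_comp 2 [b, 0] [a, 0]}"
  using assms
  by (auto simp: quad_trees_dias_gens_iff dias_word_gen_comp max_def split: if_splits)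

lemma dias_fibre_right_equal:
  assumes "d \<in> {1..\<gamma>}"
  shows "dias_fibre \<gamma> [d, d, 0] = insert (gen_comp 2 [d, 0] [d, 0])
    ((\<lambda>c. gen_comp 1 [d, 0] [c, 0]) ` {1..d} \<union> (\<lambda>c. gen_comp 1 [d, 0] [0, c]) ` {1..d})"
  using assms
  by (auto simp: quad_trees_dias_gens_iff dias_word_gen_comp max_def split: if_splits)

text \<open>The seven cases match the seven families of relators.\<close>

lemma dias_word_quad_trees_cases:
  assumes "w \<in> dias_word ` quad_trees (dias_gens \<gamma>)"
  obtains (middle) a b where "a \<in> {1..\<gamma>}" "b \<in> {1..\<gamma>}" "w = [b, 0, a]"
  | (left_less) a b where "a \<in> {1..\<gamma>}" "b \<in> {1..\<gamma>}" "a < b" "w = [0, a, b]"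
  | (left_greater) a b where "a \<in> {1..\<gamma>}" "b \<in> {1..\<gamma>}" "a < b" "w = [0, b, a]"
  | (left_equal) d where "d \<in> {1..\<gamma>}" "w = [0, d, d]"
  | (right_less) a b where "a \<in> {1..\<gamma>}" "b \<in> {1..\<gamma>}" "a < b" "w = [a, b, 0]"
  | (right_greater) a b where "a \<in> {1..\<gamma>}" "b \<in> {1..\<gamma>}" "a < b" "w = [b, a, 0]"
  | (right_equal) d where "d \<in> {1..\<gamma>}" "w = [d, d, 0]"
proof -
  from assms obtain t where t: "t \<in> quad_trees (dias_gens \<gamma>)" "w = dias_word t"
    by blast
  \<comment> \<open>A coarser description first: only the position of the zero, the other letters
    staying in range under \<open>max\<close>. Comparing these two letters then separates the
    cases.\<close>
  define S where "S = {w. \<exists>p\<in>{1..\<gamma>}. \<exists>q\<in>{1..\<gamma>}. w = [p, 0, q] \<or> w = [0, p, q] \<or> w = [p, q, 0]}"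
  have S: "[p, 0, q] \<in> S" "[0, p, q] \<in> S" "[p, q, 0] \<in> S" if "p \<in> {1..\<gamma>}" "q \<in> {1..\<gamma>}" for p q
    using that unfolding S_def by blast+
  have max: "max p q \<in> {1..\<gamma>}" if "p \<in> {1..\<gamma>}" "q \<in> {1..\<gamma>}" for p q
    using that by auto
  have "w \<in> S"
    using t(1) unfolding t(2) quad_trees_dias_gens_iff
    \<comment> \<open>The goals mention \<open>gen_comp 1\<close>, and \<open>simp only\<close> does
      not turn \<open>1\<close> into \<open>Suc 0\<close>; hence the folded equations.\<close>
    by (elim bexE disjE; hypsubst;
        simp only: dias_word_gen_comp[folded One_nat_def] max_0L max_0R S max)
  then obtain p q where pq: "p \<in> {1..\<gamma>}" "q \<in> {1..\<gamma>}"
    and w: "w = [p, 0, q] \<or> w = [0, p, q] \<or> w = [p, q, 0]"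
    unfolding S_def by blast
  consider "p < q" | "p = q" | "q < p"
    by linarith
  then show ?thesis
  proof cases
    case 1
    then show ?thesis
      using w pq middle left_less right_less by blast
  next
    case 2
    then show ?thesis
      using w pq middle left_equal right_equal by blast
  next
    case 3
    then show ?thesis
      using w pq middle left_greater right_greater by blast
  qed
qed

section \<open>The polydendriform relators, indexed by words\<close>

definition dendr_relator :: "nat \<Rightarrow> nat list \<Rightarrow> (dendr_gen tree \<Rightarrow>\<^sub>0 'k::field_char_0)" where
  "dendr_relator \<gamma> w = pm_push (map_tree harpoon) (signed_fibre_sum (dias_gens \<gamma>) dias_word w)"

lemma dendr_relator_eq_sum:
  "dendr_relator \<gamma> w =
     (\<Sum>t\<in>dias_fibre \<gamma> w. Poly_Mapping.single (map_tree harpoon t) (tree_sign t))"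
  by (simp add: dendr_relator_def signed_fibre_sum_def pm_push_sum)

lemma single_map_tree_gen_comp:
  "Poly_Mapping.single (map_tree h (gen_comp (Suc 0) x y)) 1 = quad 1 (h x) (h y)"
  "Poly_Mapping.single (map_tree h (gen_comp 2 x y)) (- 1) = - quad 2 (h x) (h y)"
  by (simp_all add: quad_def gen_comp_1 gen_comp_2 single_uminus)

text \<open>Each of these fibres has one tree of each shape, so the signs yield a
  difference.\<close>

lemma dendr_relator_pairs:
  assumes "a \<in> {1..\<gamma>}" "b \<in> {1..\<gamma>}"
  shows "dendr_relator \<gamma> [b, 0, a] = quad 1 (Lharp a) (Rharp b) - quad 2 (Rharp b) (Lharp a)"
    and "a < b \<Longrightarrow>
      dendr_relator \<gamma> [0, b, a] = quad 1 (Lharp a) (Lharp b) - quad 2 (Lharp a) (Rharp b)"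
    and "a < b \<Longrightarrow>
      dendr_relator \<gamma> [a, b, 0] = quad 1 (Rharp a) (Lharp b) - quad 2 (Rharp a) (Rharp b)"
    and "a < b \<Longrightarrow>
      dendr_relator \<gamma> [0, a, b] = quad 1 (Lharp b) (Lharp a) - quad 2 (Lharp a) (Lharp b)"
    and "a < b \<Longrightarrow>
      dendr_relator \<gamma> [b, a, 0] = quad 1 (Rharp a) (Rharp b) - quad 2 (Rharp b) (Rharp a)"
  using assms
  by (simp_all add: dendr_relator_eq_sum dias_fibre_middle dias_fibre_left_less
      dias_fibre_left_greater dias_fibre_right_less dias_fibre_right_greater
      single_map_tree_gen_comp harpoon_simps)

lemma dendr_relator_left_equal:
  assumes d: "d \<in> {1..\<gamma>}"
  shows "dendr_relator \<gamma> [0, d, d] = quad 1 (Lharp d) (Lharp d) -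
    (\<Sum>c\<in>{1..d}. quad 2 (Lharp d) (Lharp c) + quad 2 (Lharp d) (Rharp c))"
proof -
  let ?s = "\<lambda>t. Poly_Mapping.single (map_tree harpoon t) (tree_sign t)"
  have "dendr_relator \<gamma> [0, d, d] = ?s (gen_comp 1 [0, d] [0, d]) +
      ((\<Sum>t\<in>(\<lambda>c. gen_comp 2 [0, d] [0, c]) ` {1..d}. ?s t) +
       (\<Sum>t\<in>(\<lambda>c. gen_comp 2 [0, d] [c, 0]) ` {1..d}. ?s t))"
    unfolding dendr_relator_eq_sum dias_fibre_left_equal[OF d]
    \<comment> \<open>The first tree has the other shape, and the two families differ in the side of
      the zero in the inserted generator, as \<open>c \<ge> 1\<close>.\<close>
    by (subst sum.insert, simp, force, subst sum.union_disjoint) auto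
  also have "(\<Sum>t\<in>(\<lambda>c. gen_comp 2 [0, d] [0, c]) ` {1..d}. ?s t) =
      (\<Sum>c\<in>{1..d}. - quad 2 (Lharp d) (Lharp c))"
    by (subst sum.reindex)
      (auto intro!: inj_onI sum.cong simp: single_map_tree_gen_comp harpoon_simps)
  also have "(\<Sum>t\<in>(\<lambda>c. gen_comp 2 [0, d] [c, 0]) ` {1..d}. ?s t) =
      (\<Sum>c\<in>{1..d}. - quad 2 (Lharp d) (Rharp c))"
    by (subst sum.reindex)
      (auto intro!: inj_onI sum.cong simp: single_map_tree_gen_comp harpoon_simps)
  also have "?s (gen_comp 1 [0, d] [0, d]) = quad 1 (Lharp d) (Lharp d)"
    by (simp add: single_map_tree_gen_comp harpoon_simps)
  finally show ?thesis
    by (simp add: sum_negf sum.distrib algebra_simps)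
qed

text \<open>The shapes trade roles here: the isolated tree is a \<open>\<circ>\<^sub>2\<close>, so
  the minus sign falls on it and the sum is positive.\<close>

lemma dendr_relator_right_equal:
  assumes d: "d \<in> {1..\<gamma>}"
  shows "dendr_relator \<gamma> [d, d, 0] =
    (\<Sum>c\<in>{1..d}. quad 1 (Rharp d) (Rharp c) + quad 1 (Rharp d) (Lharp c)) -
      quad 2 (Rharp d) (Rharp d)"
proof -
  let ?s = "\<lambda>t. Poly_Mapping.single (map_tree harpoon t) (tree_sign t)"
  have "dendr_relator \<gamma> [d, d, 0] = ?s (gen_comp 2 [d, 0] [d, 0]) +
      ((\<Sum>t\<in>(\<lambda>c. gen_comp 1 [d, 0] [c, 0]) ` {1..d}. ?s t) +
       (\<Sum>t\<in>(\<lambda>c. gen_comp 1 [d, 0] [0, c]) ` {1..d}. ?s t))"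
    unfolding dendr_relator_eq_sum dias_fibre_right_equal[OF d]
    by (subst sum.insert, simp, force, subst sum.union_disjoint) auto
  also have "(\<Sum>t\<in>(\<lambda>c. gen_comp 1 [d, 0] [c, 0]) ` {1..d}. ?s t) =
      (\<Sum>c\<in>{1..d}. quad 1 (Rharp d) (Rharp c))"
    using d by (subst sum.reindex)
      (auto intro!: inj_onI sum.cong simp: single_map_tree_gen_comp harpoon_simps)
  also have "(\<Sum>t\<in>(\<lambda>c. gen_comp 1 [d, 0] [0, c]) ` {1..d}. ?s t) =
      (\<Sum>c\<in>{1..d}. quad 1 (Rharp d) (Lharp c))"
    using d by (subst sum.reindex)
      (auto intro!: inj_onI sum.cong simp: single_map_tree_gen_comp harpoon_simps)
  also have "?s (gen_comp 2 [d, 0] [d, 0]) = - quad 2 (Rharp d) (Rharp d)"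
    using d by (simp add: single_map_tree_gen_comp harpoon_simps)
  finally show ?thesis
    by (simp add: sum.distrib)
qed

lemmas dendr_relator_simps =
  dendr_relator_pairs dendr_relator_left_equal dendr_relator_right_equal

text \<open>The witnesses evaluate with every \<open>max\<close> taken against 0, so they work for
  either order of \<open>a\<close> and \<open>b\<close>.\<close>

lemma dias_words_in_image:
  assumes "a \<in> {1..\<gamma>}" "b \<in> {1..\<gamma>}"
  shows "[b, 0, a] \<in> dias_word ` quad_trees (dias_gens \<gamma>)"
    and "[0, a, b] \<in> dias_word ` quad_trees (dias_gens \<gamma>)"
    and "[a, b, 0] \<in> dias_word ` quad_trees (dias_gens \<gamma>)"
proof -
  have "gen_comp 2 [b, 0] [0, a] \<in> quad_trees (dias_gens \<gamma>)"
    "gen_comp 1 [0, b] [0, a] \<in> quad_trees (dias_gens \<gamma>)"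
    "gen_comp 2 [a, 0] [b, 0] \<in> quad_trees (dias_gens \<gamma>)"
    using assms by (auto simp: quad_trees_dias_gens_iff)
  note this[THEN imageI, where f = dias_word]
  then show "[b, 0, a] \<in> dias_word ` quad_trees (dias_gens \<gamma>)"
    "[0, a, b] \<in> dias_word ` quad_trees (dias_gens \<gamma>)"
    "[a, b, 0] \<in> dias_word ` quad_trees (dias_gens \<gamma>)"
    by (simp_all add: dias_word_gen_comp)
qed

lemma dendr_relators_eq:
  "(dendr_relators \<gamma> :: (_ \<Rightarrow>\<^sub>0 'k::field_char_0) set) =
     dendr_relator \<gamma> ` dias_word ` quad_trees (dias_gens \<gamma>)"
proof
  show "dendr_relator \<gamma> ` dias_word ` quad_trees (dias_gens \<gamma>)
      \<subseteq> (dendr_relators \<gamma> :: (_ \<Rightarrow>\<^sub>0 'k) set)"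
  proof (rule image_subsetI)
    fix w assume "w \<in> dias_word ` quad_trees (dias_gens \<gamma>)"
    then show "dendr_relator \<gamma> w \<in> (dendr_relators \<gamma> :: (_ \<Rightarrow>\<^sub>0 'k) set)"
      by (cases rule: dias_word_quad_trees_cases)
        (simp only: dendr_relator_simps dendr_relators_def Un_iff mem_Collect_eq, blast)+
  qed
  show "(dendr_relators \<gamma> :: (_ \<Rightarrow>\<^sub>0 'k) set)
      \<subseteq> dendr_relator \<gamma> ` dias_word ` quad_trees (dias_gens \<gamma>)"
  proof
    fix r :: "dendr_gen tree \<Rightarrow>\<^sub>0 'k"
    assume "r \<in> dendr_relators \<gamma>"
    then show "r \<in> dendr_relator \<gamma> ` dias_word ` quad_trees (dias_gens \<gamma>)"
      \<comment> \<open>Read from right to left, the computed equations turn each listed relator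
        into the one of its word. Those right-hand sides do not mention \<open>\<gamma>\<close>, so
        it is instantiated explicitly.\<close>
      unfolding dendr_relators_def
      by (elim UnE CollectE exE conjE,
          simp_all only: dendr_relator_simps[where \<gamma> = \<gamma>, symmetric])
        (intro imageI dias_words_in_image; assumption)+
  qed
qed

text \<open>A linear map commutes with spans, so it suffices to transport the spanning fibre sums,
  which become the relators.\<close>

lemma pm_push_annihilator:
  "pm_push (map_tree harpoon) ` annihilator (dias_gens \<gamma>) (dias_relations \<gamma>) =
     (dendr_relations \<gamma> :: (dendr_gen tree \<Rightarrow>\<^sub>0 'k::field_char_0) set)"
proof -
  interpret push: module_hom "pm_scale :: 'k \<Rightarrow> _" pm_scale "pm_push (map_tree harpoon)"
    by unfold_locales (simp_all add: pm_push_add pm_push_scale)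
  have "finite (dias_gens \<gamma>)"
    by (simp add: dias_gens_eq)
  then have "annihilator (dias_gens \<gamma>) (dias_relations \<gamma>) =
      (pm.span (signed_fibre_sum (dias_gens \<gamma>) dias_word ` dias_word ` quad_trees (dias_gens \<gamma>))
        :: (_ \<Rightarrow>\<^sub>0 'k) set)"
    unfolding dias_relations_def dias_canonical_eq by (rule annihilator_kernel)
  then show ?thesis
    by (simp add: push.span_image[symmetric] dendr_relations_def dendr_relators_eq image_image
        dendr_relator_def)
qed

theorem theorem2p1p1:
  fixes \<gamma> :: nat
  shows "admits_presentation
           (Dendr \<gamma> :: ('k::field_char_0, (nat list tree \<Rightarrow>\<^sub>0 'k) set) ns_operad)
           (dendr_gens \<gamma>) (dendr_relations \<gamma>)"
  \<comment> \<open>With the target relations rewritten as the renamed annihilator, only a change of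
    generators along \<open>harpoon\<close> is left.\<close>
  unfolding Dendr_def koszul_dual_def pm_push_annihilator[symmetric]
  by (rule admits_presentation_rename[OF bij_betw_harpoon]) (auto simp: annihilator_def)

end
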